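(* Let $\rho:[0,\infty)\to[0,\infty)$ be a right-continuous function such that $\rho(t)/\sqrt{t}$ is increasing in $t>0$. Suppose that, for some Lebesgue measurable functions $\phi_1,\phi_2:(0,\infty)\to(0,\infty)$ and for some family $Z=(Z_x)_{x\ge 0}$ of $[0,\infty]$-valued random variables, it holds that $$\frac{1}{\lambda}\,Y^{(\phi_1(\lambda)\rho)}_{\phi_2(\lambda)x}\ \stackrel{\mathrm{d}}{\longrightarrow}\ Z_x\quad\text{as }\lambda\to 0+,\ \text{ for all } x\ge 0 .$$ Suppose, moreover, that there exists a constant $p\in[0,\infty)$ such that $\phi_2(\lambda)/\sqrt{\lambda}\to p$ as $\lambda\to 0+$. Then one of the following four assertions holds: (i) $\phi_1(\lambda)\rho(\lambda t)/\sqrt{\lambda}\to 0$ as $\lambda\to 0+$ for all $t>0$. In this case, $Z_x\stackrel{\mathrm{d}}{=}Y^{(0)}_{px}$ for all $x\ge 0$. (ii) There exists $t_0\in(0,\infty)$ such that, as $\lambda\to0+$, $$\frac{\phi_1(\lambda)\rho(\lambda t)}{\sqrt{\lambda t}}\longrightarrow\begin{cases}0&\text{if }0<t<t_0,\\ \infty&\text{if }t>t_0,\end{cases}\qquad\text{and}\qquad\frac{\phi_2(\lambda)}{\sqrt{\lambda}}\longrightarrow p .$$ In this case, $Z_x\stackrel{\mathrm{d}}{=}\min\{Y^{(0)}_{px},t_0\}$ for all $x\ge 0$. (iii) There exist $\alpha\ge 1/2$ and $c\in(0,\infty)$ such that, as $\lambda\to 0+$, $$\frac{\rho(\lambda t)}{\rho(\lambda)}\longrightarrow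 t^{\alpha}\ \text{ for all } t>0,\qquad\frac{\rho(\lambda)}{\sqrt{\lambda}}\,\phi_1(\lambda)\longrightarrow c,\qquad\frac{1}{\sqrt{\lambda}}\,\phi_2(\lambda)\longrightarrow p .$$ In this case, $Z_x\stackrel{\mathrm{d}}{=}Z^{(c,\alpha)}_{px}$ for all $x\ge 0$. (iv) (Degenerate case.) $P(Z_x=0)=1$ for all $x\in(0,\infty)$.
   Context: "Increasing" means non-decreasing throughout. $B=(B_t)_{t\ge 0}$ is a one-dimensional standard Brownian motion started at $0$. A family of random variables $(Y_x)_{x\ge 0}$ is called a d-inverse on $[0,\infty)$ of a $[-\infty,\infty]$-valued process $X=(X_t)_{t\ge 0}$ if every $Y_x$ takes values in $[0,\infty]$ and, for every $x\ge 0$ and for a.e. $t\in(0,\infty)$, $P(X_t\ge x)=P(Y_x\le t)$. (The law of each $Y_x$ is thereby determined.) A d-inverse exists if and only if $P(X_t\ge x)$ is increasing in $t\in(0,\infty)$ for every $x\ge0$. For a right-continuous function $\rho:[0,\infty)\to\mathbb{R}$ such that $\rho(t)/\sqrt{t}$ is increasing in $t>0$, the process $B^{(\rho)}_t=B_t+\rho(t)$ admits a d-inverse on $[0,\infty)$, denoted $(Y^{(\rho)}_x)_{x\ge 0}$. Thus $Y^{(\phi_1(\lambda)\rho)}$ is the d-inverse of $B_t+\phi_1(\lambda)\rho(t)$, and $Y^{(0)}$ is the d-inverse of Brownian motion without drift, i.e. $Y^{(0)}_x\stackrel{\mathrm{d}}{=}(x/B_1)^2 1_{\{B_1>0\}}+\infty\,1_{\{B_1\le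 0\}}$ for $x\ge 0$. For $\alpha\ge 1/2$ and $c\in[0,\infty)$, $(Z^{(c,\alpha)}_x)_{x\ge 0}$ denotes the d-inverse on $[0,\infty)$ of the Brownian motion with power drift $R^{(c,\alpha)}_t=B_t+ct^{\alpha}$, $t\ge0$. $X\stackrel{\mathrm{d}}{=}Y$ means $P(X\le u)=P(Y\le u)$ for all $u\in\mathbb{R}$. $X^{(\lambda)}\stackrel{\mathrm{d}}{\longrightarrow}X$ as $\lambda\to0+$ means $P(X^{(\lambda)}\le u)\to P(X\le u)$ for all $u\in\mathbb{R}$ with $P(X=u)=0$. *)

theory Defs
  imports "HOL-Probability.Probability"
begin

definition standard_brownian_motion :: "'a measure \<Rightarrow> (real \<Rightarrow> 'a \<Rightarrow> real) \<Rightarrow> bool" where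
  "standard_brownian_motion M B \<longleftrightarrow>
     prob_space M \<and>
     (\<forall>t\<ge>0. B t \<in> borel_measurable M) \<and>
     (AE \<omega> in M. B 0 \<omega> = 0) \<and>
     (\<forall>s t. 0 \<le> s \<and> s < t \<longrightarrow>
        distributed M lborel (\<lambda>\<omega>. B t \<omega> - B s \<omega>) (\<lambda>y. ennreal (normal_density 0 (sqrt (t - s)) y))) \<and>
     (\<forall>(n::nat) \<tau>. 0 \<le> \<tau> 0 \<and> (\<forall>i<n. \<tau> i < \<tau> (Suc i)) \<longrightarrow>
        prob_space.indep_vars M (\<lambda>_. borel) (\<lambda>i \<omega>. B (\<tau> (Suc i)) \<omega> - B (\<tau> i) \<omega>) {..<n}) \<and>
     (AE \<omega> in M. continuous_on {0..} (\<lambda>t. B t \<omega>))"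

text \<open>
  Processes and families of random variables are indexed by \<^typ>\<open>real\<close>, but only
  nonnegative indices matter.  The family \<open>Y\<close> may live on another probability space than the
  process \<open>X\<close>; \<open>[0,\<infinity>]\<close>-valued random variables are nonnegative \<^typ>\<open>ereal\<close>-valued ones.
\<close>

definition d_inverse ::
  "'b measure \<Rightarrow> (real \<Rightarrow> 'b \<Rightarrow> ereal) \<Rightarrow> 'a measure \<Rightarrow> (real \<Rightarrow> 'a \<Rightarrow> ereal) \<Rightarrow> bool" where
  "d_inverse N Y M X \<longleftrightarrow>
     prob_space M \<and> (\<forall>t\<ge>0. X t \<in> borel_measurable M) \<and>
     prob_space N \<and>
     (\<forall>x\<ge>0. Y x \<in> borel_measurable N \<and> (\<forall>\<omega>\<in>space N. 0 \<le> Y x \<omega>)) \<and>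
     (\<forall>x\<ge>0. AE t in lborel. 0 < t \<longrightarrow>
        measure M {\<omega> \<in> space M. X t \<omega> \<ge> ereal x} = measure N {\<omega> \<in> space N. Y x \<omega> \<le> ereal t})"

text \<open>For such a drift \<open>\<rho>\<close>, the process \<open>B t + \<rho> t\<close> has a d-inverse; values of \<open>\<rho>\<close> at negative
  times are irrelevant.\<close>

definition admissible_drift :: "(real \<Rightarrow> real) \<Rightarrow> bool" where
  "admissible_drift \<rho> \<longleftrightarrow>
     (\<forall>t\<ge>0. continuous (at_right t) \<rho>) \<and> mono_on {0<..} (\<lambda>t. \<rho> t / sqrt t)"

definition eq_distr :: "'a measure \<Rightarrow> ('a \<Rightarrow> ereal) \<Rightarrow> 'b measure \<Rightarrow> ('b \<Rightarrow> ereal) \<Rightarrow> bool" where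
  "eq_distr M X N Y \<longleftrightarrow>
     (\<forall>u::real. measure M {\<omega> \<in> space M. X \<omega> \<le> ereal u} = measure N {\<omega> \<in> space N. Y \<omega> \<le> ereal u})"

definition conv_distr_at_0 ::
  "(real \<Rightarrow> 'a measure) \<Rightarrow> (real \<Rightarrow> 'a \<Rightarrow> ereal) \<Rightarrow> 'b measure \<Rightarrow> ('b \<Rightarrow> ereal) \<Rightarrow> bool" where
  "conv_distr_at_0 M X N Y \<longleftrightarrow>
     (\<forall>u::real. measure N {\<omega> \<in> space N. Y \<omega> = ereal u} = 0 \<longrightarrow>
        ((\<lambda>l. measure (M l) {\<omega> \<in> space (M l). X l \<omega> \<le> ereal u})
           \<longlongrightarrow> measure N {\<omega> \<in> space N. Y \<omega> \<le> ereal u}) (at_right 0))"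

end

theory Submission
  imports Defs
begin

text \<open>
  Scaling turns the convergence hypothesis into convergence of
  \<open>\<Phi>(h\<^sub>l(u) - (\<phi>\<^sub>2(l)/\<surd>l) x/\<surd>u)\<close>, where \<open>\<Phi>\<close> is the standard normal distribution function and
  \<open>h\<^sub>l(u) = \<phi>\<^sub>1(l) k(l u)\<close> with \<open>k(t) = \<rho>(t)/\<surd>t\<close> increasing.  Taking \<open>x = 0\<close>, \<open>h\<^sub>l(u)\<close> has a limit in
  \<open>[0,\<infinity>]\<close> for all but countably many \<open>u\<close>.  If this limit is finite and positive at two distinct
  points, then \<open>k\<close> is regularly varying at 0, which gives a power drift; otherwise the limit is
  0 or \<open>\<infinity>\<close> off a countable set, and by monotonicity it is a step function.
\<close>

section \<open>The normal distribution function\<close>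

abbreviation normal_cdf :: "real \<Rightarrow> real" where
  "normal_cdf \<equiv> cdf std_normal_distribution"

lemma continuous_normal_cdf: "isCont normal_cdf x"
proof -
  interpret real_distribution std_normal_distribution by (rule real_dist_normal_dist)
  have "AE y in lborel. y \<in> {x} \<longrightarrow> ennreal (std_normal_density y) = 0"
    using AE_lborel_singleton[of x] by eventually_elim simp
  then have "{x} \<in> null_sets std_normal_distribution"
    by (simp add: null_sets_density_iff)
  then show ?thesis
    by (simp add: isCont_cdf null_setsD1 measure_def)
qed

lemma strict_mono_normal_cdf: "strict_mono normal_cdf"
proof (rule strict_monoI)
  interpret real_distribution std_normal_distribution by (rule real_dist_normal_dist)
  fix a b :: real assume "a < b"
  have "{a<..b} \<notin> null_sets std_normal_distribution"
  proof
    assume "{a<..b} \<in> null_sets std_normal_distribution"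
    then have "AE x in lborel. x \<in> {a<..b} \<longrightarrow> ennreal (std_normal_density x) = 0"
      by (subst (asm) null_sets_density_iff) auto
    then have "AE x in lborel. x \<notin> {a<..b}"
      by eventually_elim (auto simp: normal_density_pos[THEN less_imp_neq, symmetric])
    then have "emeasure lborel {a<..b} = 0"
      by (subst (asm) AE_iff_measurable[of "{a<..b}"]) auto
    with \<open>a < b\<close> show False by simp
  qed
  then have "prob {a<..b} \<noteq> 0"
    by (simp add: null_sets_def emeasure_eq_measure)
  then show "normal_cdf a < normal_cdf b"
    using cdf_diff_eq[OF \<open>a < b\<close>] measure_nonneg[of std_normal_distribution "{a<..b}"] by linarith
qed

text \<open>\<open>normal_cdf\<close> is a continuous strictly increasing bijection onto its range,
  so convergence of \<open>normal_cdf (f l)\<close> can be pulled back to \<open>f\<close>.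
  Nonnegativity of \<open>f\<close> puts the limit \<open>y\<close> at or above
  \<open>normal_cdf 0\<close>. Either \<open>y\<close> is attained at some \<open>a \<ge> 0\<close>,
  or it exceeds every value of \<open>normal_cdf\<close>, which forces divergence.\<close>

lemma normal_cdf_limit_cases:
  assumes F: "F \<noteq> bot" and lim: "((\<lambda>l. normal_cdf (f l)) \<longlongrightarrow> y) F"
    and nonneg: "\<forall>\<^sub>F l in F. f l \<ge> 0"
  shows "(\<exists>a\<ge>0. (f \<longlongrightarrow> a) F) \<or> filterlim f at_top F"
proof -
  interpret real_distribution std_normal_distribution by (rule real_dist_normal_dist)
  note less_iff = strict_mono_less[OF strict_mono_normal_cdf]
  note le_iff = strict_mono_less_eq[OF strict_mono_normal_cdf]
  have "\<forall>\<^sub>F l in F. normal_cdf 0 \<le> normal_cdf (f l)"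
    using nonneg by (simp add: le_iff)
  then have ge: "normal_cdf 0 \<le> y" by (rule tendsto_lowerbound[OF lim _ F])
  show ?thesis
  proof (cases "\<exists>b. y \<le> normal_cdf b")
    case True
    then obtain b where b: "y \<le> normal_cdf b" by auto
    with ge have "0 \<le> b" using le_iff order_trans by blast
    then obtain a where a: "0 \<le> a" "normal_cdf a = y"
      using IVT'[of normal_cdf 0 y b] ge b continuous_normal_cdf
      by (metis continuous_at_imp_continuous_on)
    have "(f \<longlongrightarrow> a) F"
    proof (rule order_tendstoI)
      fix c assume "c < a"
      then show "\<forall>\<^sub>F l in F. c < f l"
        using order_tendstoD(1)[OF lim, of "normal_cdf c"] a less_iff by auto
    next
      fix c assume "a < c"
      then show "\<forall>\<^sub>F l in F. f l < c"
        using order_tendstoD(2)[OF lim, of "normal_cdf c"] a less_iff by auto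
    qed
    with a show ?thesis by auto
  next
    case False
    then have "\<forall>\<^sub>F l in F. b < f l" for b
      using order_tendstoD(1)[OF lim, of "normal_cdf b"] by (simp add: not_le less_iff)
    then show ?thesis by (simp add: filterlim_at_top_dense)
  qed
qed

section \<open>Brownian motion with drift and d-inverses\<close>

text \<open>By symmetry, the negated standardised increment is again standard normal, and the event
  becomes a lower tail of it. The increment \<open>B t - B 0\<close> stands in for
  \<open>B t\<close>, since \<open>B 0\<close> vanishes only almost everywhere.\<close>

lemma brownian_motion_tail:
  assumes "standard_brownian_motion M B" and "t > 0"
  shows "measure M {\<omega> \<in> space M. ereal (B t \<omega> + r) \<ge> ereal x} = normal_cdf ((r - x) / sqrt t)"
proof -
  interpret prob_space M using assms by (simp add: standard_brownian_motion_def)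
  have [measurable]: "B t \<in> borel_measurable M" "B 0 \<in> borel_measurable M"
    using assms by (auto simp: standard_brownian_motion_def)
  have B0: "AE \<omega> in M. B 0 \<omega> = 0" using assms by (auto simp: standard_brownian_motion_def)
  have "distributed M lborel (\<lambda>\<omega>. B t \<omega> - B 0 \<omega>) (normal_density 0 (sqrt (t - 0)))"
    using assms unfolding standard_brownian_motion_def by blast
  from normal_density_affine[OF this, of "- 1 / sqrt t" 0] \<open>t > 0\<close>
  have D: "distributed M lborel (\<lambda>\<omega>. - ((B t \<omega> - B 0 \<omega>) / sqrt t)) std_normal_density"
    by simp
  have "measure M {\<omega> \<in> space M. ereal (B t \<omega> + r) \<ge> ereal x} =
      prob {\<omega> \<in> space M. - ((B t \<omega> - B 0 \<omega>) / sqrt t) \<le> (r - x) / sqrt t}"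
  proof (rule measure_eq_AE)
    show "AE \<omega> in M. \<omega> \<in> {\<omega> \<in> space M. ereal (B t \<omega> + r) \<ge> ereal x} \<longleftrightarrow>
        \<omega> \<in> {\<omega> \<in> space M. - ((B t \<omega> - B 0 \<omega>) / sqrt t) \<le> (r - x) / sqrt t}"
      using B0
    proof eventually_elim
      case (elim \<omega>)
      have "- (B t \<omega> / sqrt t) \<le> (r - x) / sqrt t \<longleftrightarrow> x \<le> B t \<omega> + r"
        using divide_le_cancel[of "- B t \<omega>" "sqrt t" "r - x"] \<open>t > 0\<close> by auto
      with elim show ?case by simp
    qed
  qed measurable
  also have "\<dots> = measure (distr M lborel (\<lambda>\<omega>. - ((B t \<omega> - B 0 \<omega>) / sqrt t))) {..(r - x) / sqrt t}"
    by (subst measure_distr) (auto intro!: arg_cong[where f = prob])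
  also have "\<dots> = normal_cdf ((r - x) / sqrt t)"
    using distributed_distr_eq_density[OF D] by (simp add: cdf_def)
  finally show ?thesis .
qed

text \<open>A disagreement at \<open>t\<close> would persist on some interval
  \<open>{t<..<b}\<close> by right-continuity, and this interval has positive Lebesgue measure. This
  upgrades the almost-everywhere identities in the definition of a d-inverse to pointwise ones;
  \<open>a = t\<close> is allowed, so an identity on the positive axis also reaches the point
  0.\<close>

lemma continuous_at_right_eq_AE:
  fixes F G :: "real \<Rightarrow> real"
  assumes F: "continuous (at_right t) F" and G: "continuous (at_right t) G"
    and eq: "AE u in lborel. a < u \<longrightarrow> F u = G u" and "a \<le> t"
  shows "F t = G t"
proof (rule ccontr)
  assume "F t \<noteq> G t"
  moreover have "((\<lambda>u. F u - G u) \<longlongrightarrow> F t - G t) (at_right t)"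
    using F G by (intro tendsto_diff) (auto simp: continuous_within)
  ultimately have "\<forall>\<^sub>F u in at_right t. F u - G u \<noteq> 0"
    by (intro tendsto_imp_eventually_ne) auto
  then obtain b where b: "b > t" "\<And>u. t < u \<Longrightarrow> u < b \<Longrightarrow> F u \<noteq> G u"
    by (auto simp: eventually_at_right_field)
  have "AE u in lborel. u \<notin> {t<..<b}"
    using eq by eventually_elim (use b \<open>a \<le> t\<close> in force)
  then have "emeasure lborel {t<..<b} = 0"
    by (subst (asm) AE_iff_measurable[of "{t<..<b}"]) auto
  with \<open>t < b\<close> show False by simp
qed

lemma (in finite_measure) continuous_at_right_measure_ereal_le:
  assumes [measurable]: "X \<in> borel_measurable M"
  shows "continuous (at_right a) (\<lambda>u. measure M {\<omega> \<in> space M. X \<omega> \<le> ereal u})"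
  unfolding continuous_within
proof (rule tendsto_at_right_sequentially[where b = "a + 1"])
  fix f :: "nat \<Rightarrow> real" assume f: "decseq f" "f \<longlonglongrightarrow> a"
  have "(\<lambda>n. measure M {\<omega> \<in> space M. X \<omega> \<le> ereal (f n)}) \<longlonglongrightarrow>
      measure M (\<Inter>n. {\<omega> \<in> space M. X \<omega> \<le> ereal (f n)})"
  proof (rule finite_Lim_measure_decseq)
    show "decseq (\<lambda>n. {\<omega> \<in> space M. X \<omega> \<le> ereal (f n)})"
      using f(1) by (auto simp: decseq_def intro: order_trans)
  qed auto
  also have "(\<Inter>n. {\<omega> \<in> space M. X \<omega> \<le> ereal (f n)}) = {\<omega> \<in> space M. X \<omega> \<le> ereal a}"
  proof -
    have "X \<omega> \<le> ereal a \<longleftrightarrow> (\<forall>n. X \<omega> \<le> ereal (f n))" for \<omega>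
      using decseq_ge[OF f] tendsto_ereal[OF f(2)]
      by (auto intro: order_trans LIMSEQ_le_const)
    then show ?thesis by auto
  qed
  finally show "(\<lambda>n. measure M {\<omega> \<in> space M. X \<omega> \<le> ereal (f n)}) \<longlonglongrightarrow>
      measure M {\<omega> \<in> space M. X \<omega> \<le> ereal a}" .
qed simp

text \<open>The push-forward of the measure under \<open>X\<close> is finite and so has only
  countably many atoms; the real ones are pulled back along the injection
  \<open>ereal\<close>.\<close>

lemma (in finite_measure) countable_atoms_ereal:
  assumes [measurable]: "X \<in> borel_measurable M"
  shows "countable {u :: real. measure M {\<omega> \<in> space M. X \<omega> = ereal u} \<noteq> 0}"
proof -
  interpret D: finite_measure "distr M borel X" by (rule finite_measure_distr) simp
  have "measure (distr M borel X) {ereal u} = measure M {\<omega> \<in> space M. X \<omega> = ereal u}" for u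
    by (subst measure_distr) (auto intro!: arg_cong[where f = "measure M"])
  then have "{u. measure M {\<omega> \<in> space M. X \<omega> = ereal u} \<noteq> 0} = ereal -` {x. measure (distr M borel X) {x} \<noteq> 0}"
    by auto
  moreover have "countable (ereal ` (ereal -` {x. measure (distr M borel X) {x} \<noteq> 0}))"
    by (rule countable_subset[OF image_vimage_subset D.countable_support])
  then have "countable (ereal -` {x. measure (distr M borel X) {x} \<noteq> 0})"
    by (rule countable_image_inj_on) simp
  ultimately show ?thesis by simp
qed

text \<open>Right-continuity of distribution functions extends the identity from almost every
  \<open>u > 0\<close> to all \<open>u \<ge> 0\<close>. For negative \<open>u\<close> both events
  are empty.\<close>

lemma eq_distr_nonneg_AE:
  assumes "prob_space M" "prob_space N"
    and X: "X \<in> borel_measurable M" "\<And>\<omega>. \<omega> \<in> space M \<Longrightarrow> 0 \<le> X \<omega>"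
    and Y: "Y \<in> borel_measurable N" "\<And>\<omega>. \<omega> \<in> space N \<Longrightarrow> 0 \<le> Y \<omega>"
    and eq: "AE u in lborel. 0 < u \<longrightarrow>
      measure M {\<omega> \<in> space M. X \<omega> \<le> ereal u} = measure N {\<omega> \<in> space N. Y \<omega> \<le> ereal u}"
  shows "eq_distr M X N Y"
  unfolding eq_distr_def
proof
  fix u :: real
  interpret M: prob_space M by fact
  interpret N: prob_space N by fact
  show "measure M {\<omega> \<in> space M. X \<omega> \<le> ereal u} = measure N {\<omega> \<in> space N. Y \<omega> \<le> ereal u}"
  proof (cases "u \<ge> 0")
    case True
    with continuous_at_right_eq_AE[OF M.continuous_at_right_measure_ereal_le
        N.continuous_at_right_measure_ereal_le eq] X Y
    show ?thesis by simp
  next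
    case False
    have "{\<omega> \<in> space M. X \<omega> \<le> ereal u} = {}"
      using order_trans[OF X(2), of _ "ereal u"] False by auto
    moreover have "{\<omega> \<in> space N. Y \<omega> \<le> ereal u} = {}"
      using order_trans[OF Y(2), of _ "ereal u"] False by auto
    ultimately show ?thesis by (simp only: measure_empty)
  qed
qed

text \<open>The defining relation of a d-inverse gives this for almost every \<open>t\<close>, with
  the Brownian tail on the right. Both sides are right-continuous in \<open>t\<close>, so no
  exceptional time remains.\<close>

lemma d_inverse_drift_cdf:
  assumes B: "standard_brownian_motion M B" and r: "admissible_drift r"
    and Y: "d_inverse N Y M (\<lambda>t \<omega>. ereal (B t \<omega> + r t))"
    and "x \<ge> 0" "t > 0"
  shows "measure N {\<omega> \<in> space N. Y x \<omega> \<le> ereal t} = normal_cdf ((r t - x) / sqrt t)"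
proof -
  interpret N: prob_space N using Y by (simp add: d_inverse_def)
  have "continuous (at_right t) (\<lambda>t. measure N {\<omega> \<in> space N. Y x \<omega> \<le> ereal t})"
    using Y \<open>x \<ge> 0\<close> by (intro N.continuous_at_right_measure_ereal_le) (simp add: d_inverse_def)
  moreover have "continuous (at_right t) r"
    using r \<open>t > 0\<close> by (simp add: admissible_drift_def)
  then have "continuous (at_right t) (\<lambda>t. (r t - x) / sqrt t)"
    using \<open>t > 0\<close> by (intro continuous_intros) auto
  then have "continuous (at_right t) (\<lambda>t. normal_cdf ((r t - x) / sqrt t))"
    unfolding continuous_within by (rule isCont_tendsto_compose[OF continuous_normal_cdf])
  moreover have "AE t in lborel. 0 < t \<longrightarrow>
      measure M {\<omega> \<in> space M. ereal (B t \<omega> + r t) \<ge> ereal x} = measure N {\<omega> \<in> space N. Y x \<omega> \<le> ereal t}"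
    using Y \<open>x \<ge> 0\<close> by (simp add: d_inverse_def)
  then have "AE t in lborel. 0 < t \<longrightarrow>
      measure N {\<omega> \<in> space N. Y x \<omega> \<le> ereal t} = normal_cdf ((r t - x) / sqrt t)"
    by eventually_elim (simp add: brownian_motion_tail[OF B, simplified])
  ultimately show ?thesis
    using \<open>t > 0\<close> by (intro continuous_at_right_eq_AE[where a = 0]) auto
qed

lemma admissible_drift_power:
  assumes "c \<ge> 0" "\<alpha> \<ge> 1 / 2"
  shows "admissible_drift (\<lambda>t. c * t powr \<alpha>)"
  unfolding admissible_drift_def
proof (intro conjI allI impI mono_onI)
  fix t :: real assume "t \<ge> 0"
  have "\<forall>\<^sub>F s in at_right t. 0 \<le> s"
    using eventually_at_right_less[of t] by eventually_elim (use \<open>t \<ge> 0\<close> in simp)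
  then have "((\<lambda>t. t powr \<alpha>) \<longlongrightarrow> t powr \<alpha>) (at_right t)"
    using assms by (intro tendsto_powr' tendsto_intros) auto
  then show "continuous (at_right t) (\<lambda>t. c * t powr \<alpha>)"
    unfolding continuous_within by (rule tendsto_mult_left)
next
  fix s t :: real assume st: "s \<in> {0<..}" "t \<in> {0<..}" "s \<le> t"
  \<comment> \<open>The exponent \<alpha> - 1/2 is nonnegative, which is exactly why powers from 1/2
    upwards are admissible.\<close>
  have "u powr \<alpha> / sqrt u = u powr (\<alpha> - 1 / 2)" if "u > 0" for u
    using that by (simp add: powr_diff powr_half_sqrt)
  with st assms show "c * s powr \<alpha> / sqrt s \<le> c * t powr \<alpha> / sqrt t"
    by (simp flip: times_divide_eq_right) (intro mult_left_mono powr_mono2, auto)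
qed

lemma admissible_drift_scale:
  assumes "admissible_drift r" "c \<ge> 0"
  shows "admissible_drift (\<lambda>t. c * r t)"
  unfolding admissible_drift_def
proof (intro conjI allI impI mono_onI)
  fix t :: real assume "t \<ge> 0"
  then show "continuous (at_right t) (\<lambda>t. c * r t)"
    using assms by (intro continuous_mult_left) (simp add: admissible_drift_def)
next
  fix s t :: real assume "s \<in> {0<..}" "t \<in> {0<..}" "s \<le> t"
  then have "r s / sqrt s \<le> r t / sqrt t"
    using assms mono_onD[of "{0<..}" "\<lambda>t. r t / sqrt t" s t] by (simp add: admissible_drift_def)
  from mult_left_mono[OF this \<open>c \<ge> 0\<close>] show "c * r s / sqrt s \<le> c * r t / sqrt t" by simp
qed

section \<open>Regular variation of rescaled monotone functions\<close>

lemma filterlim_mult_at_right_0: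
  fixes s :: real
  assumes "s > 0"
  shows "filterlim (\<lambda>l. l * s) (at_right 0) (at_right 0)"
  using filtermap_times_pos_at_right[OF assms, of 0]
  by (simp add: filterlim_def mult.commute[of _ s])

text \<open>Additivity gives linearity on the integers. Monotonicity traps
  \<open>real n * f x = f (real n * x)\<close> between the values at two consecutive integers, so
  \<open>n\<close> times the deviation from linearity is at most \<open>f 1\<close> for every
  \<open>n\<close>; the deviation must vanish.\<close>

lemma additive_mono_imp_linear:
  fixes f :: "real \<Rightarrow> real"
  assumes add: "\<And>x y. f (x + y) = f x + f y" and "mono f"
  shows "f x = x * f 1"
proof -
  interpret additive f by standard (rule add)
  have nat: "f (real n * y) = real n * f y" for n y
    by (induction n) (auto simp: zero add algebra_simps)
  have int: "f (of_int m) = of_int m * f 1" for m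
  proof (cases m)
    case (nonneg n)
    then show ?thesis using nat[of n 1] by simp
  next
    case (neg n)
    then show ?thesis using nat[of "Suc n" 1] by (simp add: minus del: of_nat_Suc)
  qed
  have f1: "f 1 \<ge> 0" using monoD[OF \<open>mono f\<close>, of 0 1] zero by simp
  have bound: "real n * \<bar>f x - x * f 1\<bar> \<le> f 1" for n
  proof -
    let ?m = "\<lfloor>real n * x\<rfloor>"
    have "of_int ?m * f 1 \<le> real n * f x"
      using monoD[OF \<open>mono f\<close>, of "of_int ?m" "real n * x"] by (simp add: int nat)
    moreover have "real n * f x \<le> of_int (?m + 1) * f 1"
      using monoD[OF \<open>mono f\<close>, of "real n * x" "of_int (?m + 1)"]
      by (simp add: int nat del: of_int_add) linarith
    moreover have "of_int ?m * f 1 \<le> (real n * x) * f 1" "(real n * x) * f 1 \<le> of_int (?m + 1) * f 1"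
      using f1 by (intro mult_right_mono; linarith)+
    ultimately have "\<bar>real n * f x - (real n * x) * f 1\<bar> \<le> f 1"
      by (simp add: algebra_simps)
    also have "real n * f x - (real n * x) * f 1 = real n * (f x - x * f 1)"
      by (simp add: algebra_simps)
    finally show ?thesis
      by (simp add: abs_mult)
  qed
  have "\<bar>f x - x * f 1\<bar> = 0"
  proof (rule ccontr)
    assume "\<bar>f x - x * f 1\<bar> \<noteq> 0"
    then obtain n where "f 1 < real n * \<bar>f x - x * f 1\<bar>"
      using reals_Archimedean3[of "\<bar>f x - x * f 1\<bar>"] by auto
    with bound[of n] show False by simp
  qed
  then show ?thesis by simp
qed

text \<open>In logarithmic coordinates the multiplicative equation becomes Cauchy's additive
  equation; its slope is the exponent.\<close>

lemma multiplicative_mono_imp_powr: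
  fixes G :: "real \<Rightarrow> real"
  assumes pos: "\<And>s. s > 0 \<Longrightarrow> G s > 0"
    and mult: "\<And>s t. s > 0 \<Longrightarrow> t > 0 \<Longrightarrow> G (s * t) = G s * G t"
    and mono: "mono_on {0<..} G"
  obtains \<beta> where "\<beta> \<ge> 0" "\<And>s. s > 0 \<Longrightarrow> G s = s powr \<beta>"
proof
  let ?f = "\<lambda>x. ln (G (exp x))"
  have "mono ?f"
    using mono_onD[OF mono] pos by (intro monoI) simp
  then have lin: "?f x = x * ?f 1" for x
    by (rule additive_mono_imp_linear[rotated]) (simp add: exp_add mult pos ln_mult_pos)
  show "?f 1 \<ge> 0"
    using monoD[OF \<open>mono ?f\<close>, of 0 1] lin[of 0] by simp
  show "G s = s powr ?f 1" if "s > 0" for s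
    using arg_cong[OF lin[of "ln s"], of exp] pos[OF that] that by (simp add: powr_def mult.commute)
qed

text \<open>The limit function is multiplicative because the quotient of
  \<open>k (l * s * t)\<close> by \<open>k l\<close> telescopes through \<open>k (l * s)\<close>,
  and \<open>l * s\<close> tends to 0 from the right along with \<open>l\<close>. It inherits
  monotonicity from \<open>k\<close>, hence is a power with nonnegative exponent.\<close>

lemma regularly_varying_mono_index:
  fixes k :: "real \<Rightarrow> real"
  assumes mono: "mono_on {0<..} k" and pos: "\<And>t. t > 0 \<Longrightarrow> k t > 0"
    and lim: "\<And>s. s > 0 \<Longrightarrow> \<exists>g>0. ((\<lambda>l. k (l * s) / k l) \<longlongrightarrow> g) (at_right 0)"
  obtains \<beta> where "\<beta> \<ge> 0" "\<And>s. s > 0 \<Longrightarrow> ((\<lambda>l. k (l * s) / k l) \<longlongrightarrow> s powr \<beta>) (at_right 0)"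
proof -
  obtain G where G: "\<And>s. s > 0 \<Longrightarrow> G s > 0"
      "\<And>s. s > 0 \<Longrightarrow> ((\<lambda>l. k (l * s) / k l) \<longlongrightarrow> G s) (at_right 0)"
    using lim by metis
  have "G (s * t) = G s * G t" if s: "s > 0" and t: "t > 0" for s t
  proof (rule tendsto_unique[OF _ G(2)])
    have "((\<lambda>l. k (l * s * t) / k (l * s) * (k (l * s) / k l)) \<longlongrightarrow> G t * G s) (at_right 0)"
      by (intro tendsto_mult G s filterlim_compose[OF G(2)[OF t] filterlim_mult_at_right_0])
    then show "((\<lambda>l. k (l * (s * t)) / k l) \<longlongrightarrow> G s * G t) (at_right 0)"
      unfolding mult.commute[of "G t" "G s"]
    proof (rule tendsto_cong[THEN iffD1, rotated])
      show "\<forall>\<^sub>F l in at_right 0. k (l * s * t) / k (l * s) * (k (l * s) / k l) = k (l * (s * t)) / k l"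
        using eventually_at_right_less[of 0]
      proof eventually_elim
        case (elim l)
        then show ?case using pos[of "l * s"] s by (simp add: mult.assoc)
      qed
    qed
  qed (use s t in auto)
  moreover have "mono_on {0<..} G"
  proof (rule mono_onI)
    fix s t :: real assume st: "s \<in> {0<..}" "t \<in> {0<..}" "s \<le> t"
    show "G s \<le> G t"
    proof (rule tendsto_le[OF _ G(2) G(2)])
      show "\<forall>\<^sub>F l in at_right 0. k (l * s) / k l \<le> k (l * t) / k l"
        using eventually_at_right_less[of 0]
      proof eventually_elim
        case (elim l)
        then show ?case
          using st pos[of l] by (intro divide_right_mono mono_onD[OF mono]) auto
      qed
    qed (use st in auto)
  qed
  ultimately obtain \<beta> where "\<beta> \<ge> 0" "\<And>s. s > 0 \<Longrightarrow> G s = s powr \<beta>"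
    using multiplicative_mono_imp_powr G(1) by metis
  with that G(2) show ?thesis by metis
qed

lemma exists_between_notin_countable:
  fixes a b :: real
  assumes "countable A" "a < b"
  obtains t where "a < t" "t < b" "t \<notin> A"
proof -
  have "uncountable ({a<..<b} - A)"
    using assms by (simp add: uncountable_minus_countable uncountable_open_interval)
  then have "{a<..<b} - A \<noteq> {}" by (metis countable_empty)
  then show ?thesis using that by fastforce
qed

text \<open>The set \<open>U\<close> of points where the rescaled function diverges is closed
  upwards, so it is determined by its infimum up to that one point. The three alternatives are
  \<open>U\<close> empty, \<open>Inf U > 0\<close> (which gives the jump point) and
  \<open>Inf U = 0\<close>.\<close>

lemma rescaled_mono_zero_or_infinity:
  fixes k \<phi> :: "real \<Rightarrow> real"
  assumes mono: "mono_on {0<..} k" and nonneg: "\<And>t. t > 0 \<Longrightarrow> k t \<ge> 0"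
    and \<phi>: "\<And>l. l > 0 \<Longrightarrow> \<phi> l > 0"
    and A: "countable A"
    and lim: "\<And>t. t > 0 \<Longrightarrow> t \<notin> A \<Longrightarrow> ((\<lambda>l. \<phi> l * k (l * t)) \<longlongrightarrow> 0) (at_right 0) \<or>
      filterlim (\<lambda>l. \<phi> l * k (l * t)) at_top (at_right 0)"
  shows "(\<forall>t>0. ((\<lambda>l. \<phi> l * k (l * t)) \<longlongrightarrow> 0) (at_right 0)) \<or>
    (\<exists>t\<^sub>0>0. (\<forall>t. 0 < t \<and> t < t\<^sub>0 \<longrightarrow> ((\<lambda>l. \<phi> l * k (l * t)) \<longlongrightarrow> 0) (at_right 0)) \<and>
      (\<forall>t>t\<^sub>0. filterlim (\<lambda>l. \<phi> l * k (l * t)) at_top (at_right 0))) \<or>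
    (\<forall>t>0. filterlim (\<lambda>l. \<phi> l * k (l * t)) at_top (at_right 0))"
proof -
  define U where "U = {t. t > 0 \<and> filterlim (\<lambda>l. \<phi> l * k (l * t)) at_top (at_right 0)}"
  have le: "\<forall>\<^sub>F l in at_right 0. \<phi> l * k (l * s) \<le> \<phi> l * k (l * t)" if "0 < s" "s \<le> t" for s t
    using eventually_at_right_less[of 0]
  proof eventually_elim
    case (elim l)
    then show ?case
      using that \<phi>[of l] by (intro mult_left_mono mono_onD[OF mono]) auto
  qed
  have up: "t \<in> U" if "s \<in> U" "s \<le> t" for s t
    using that le[of s t] by (auto simp: U_def intro: filterlim_at_top_mono)
  \<comment> \<open>The point \<open>s\<close> may lie in \<open>A\<close>, where nothing is
    assumed. The value there is squeezed between 0 and the value at a nonexceptional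
    \<open>t\<close> slightly to the right, still outside \<open>U\<close>.\<close>
  have zero: "((\<lambda>l. \<phi> l * k (l * s)) \<longlongrightarrow> 0) (at_right 0)"
    if "0 < s" "s < b" "\<And>t. t < b \<Longrightarrow> t \<notin> U" for s b
  proof -
    obtain t where t: "s < t" "t < b" "t \<notin> A"
      using exists_between_notin_countable[OF A] \<open>s < b\<close> by metis
    then have "((\<lambda>l. \<phi> l * k (l * t)) \<longlongrightarrow> 0) (at_right 0)"
      using lim[of t] that by (auto simp: U_def)
    moreover have "\<forall>\<^sub>F l in at_right 0. 0 \<le> \<phi> l * k (l * s)"
      using eventually_at_right_less[of 0]
      by eventually_elim (use \<open>0 < s\<close> in \<open>simp add: nonneg \<phi> less_imp_le\<close>)
    ultimately show ?thesis
      using le[of s t] t \<open>0 < s\<close> tendsto_sandwich[OF _ _ tendsto_const] by force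
  qed
  show ?thesis
  proof (cases "U = {}")
    case True
    then have "((\<lambda>l. \<phi> l * k (l * t)) \<longlongrightarrow> 0) (at_right 0)" if "t > 0" for t
      using zero[of t "t + 1"] that by auto
    then show ?thesis by blast
  next
    case False
    have bdd: "bdd_below U" by (rule bdd_belowI[of _ 0]) (auto simp: U_def)
    have above: "t \<in> U" if "t > Inf U" for t
      using that up cInf_lessD[OF False that] by force
    have below: "t \<notin> U" if "t < Inf U" for t
      using that cInf_lower[OF _ bdd] by force
    have "Inf U \<ge> 0" using False by (intro cInf_greatest) (auto simp: U_def)
    then consider "Inf U = 0" | "Inf U > 0" by linarith
    then show ?thesis
    proof cases
      case 1
      then show ?thesis using above by (auto simp: U_def)
    next
      case 2
      then show ?thesis using above zero[OF _ _ below] by (auto simp: U_def)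
    qed
  qed
qed

text \<open>The split is by the set \<open>R\<close> of points with a finite positive limit. With at
  most one such point the zero-or-infinity dichotomy applies. Two distinct points fix the growth of
  \<open>k\<close> along the geometric sequence generated by their ratio; monotonicity then spreads
  finite positive limits to all points outside \<open>A\<close>, and this makes \<open>k\<close>
  regularly varying at 0.\<close>

lemma rescaled_mono_limit_cases:
  fixes k \<phi> :: "real \<Rightarrow> real"
  assumes mono: "mono_on {0<..} k" and nonneg: "\<And>t. t > 0 \<Longrightarrow> k t \<ge> 0"
    and \<phi>: "\<And>l. l > 0 \<Longrightarrow> \<phi> l > 0"
    and A: "countable A"
    and lim: "\<And>t. t > 0 \<Longrightarrow> t \<notin> A \<Longrightarrow> (\<exists>a\<ge>0. ((\<lambda>l. \<phi> l * k (l * t)) \<longlongrightarrow> a) (at_right 0)) \<or>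
      filterlim (\<lambda>l. \<phi> l * k (l * t)) at_top (at_right 0)"
  obtains
    (zero) "\<And>t. t > 0 \<Longrightarrow> ((\<lambda>l. \<phi> l * k (l * t)) \<longlongrightarrow> 0) (at_right 0)"
  | (jump) t\<^sub>0 where "t\<^sub>0 > 0" "\<And>t. 0 < t \<Longrightarrow> t < t\<^sub>0 \<Longrightarrow> ((\<lambda>l. \<phi> l * k (l * t)) \<longlongrightarrow> 0) (at_right 0)"
      "\<And>t. t > t\<^sub>0 \<Longrightarrow> filterlim (\<lambda>l. \<phi> l * k (l * t)) at_top (at_right 0)"
  | (power) c \<beta> where "c > 0" "\<beta> \<ge> 0" "((\<lambda>l. \<phi> l * k l) \<longlongrightarrow> c) (at_right 0)"
      "\<And>t. t > 0 \<Longrightarrow> ((\<lambda>l. k (l * t) / k l) \<longlongrightarrow> t powr \<beta>) (at_right 0)"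
  | (infinity) "\<And>t. t > 0 \<Longrightarrow> filterlim (\<lambda>l. \<phi> l * k (l * t)) at_top (at_right 0)"
proof -
  define R where "R = {t. t > 0 \<and> (\<exists>a>0. ((\<lambda>l. \<phi> l * k (l * t)) \<longlongrightarrow> a) (at_right 0))}"
  have lim': "((\<lambda>l. \<phi> l * k (l * t)) \<longlongrightarrow> 0) (at_right 0) \<or>
      filterlim (\<lambda>l. \<phi> l * k (l * t)) at_top (at_right 0)" if "t > 0" "t \<notin> A \<union> R" for t
    using lim[of t] that by (auto simp: R_def) (metis less_eq_real_def)
  show ?thesis
  proof (cases "\<exists>t\<^sub>1\<in>R. \<exists>t\<^sub>2\<in>R. t\<^sub>1 < t\<^sub>2")
    case False
    then have "\<And>t\<^sub>1 t\<^sub>2. t\<^sub>1 \<in> R \<Longrightarrow> t\<^sub>2 \<in> R \<Longrightarrow> t\<^sub>1 = t\<^sub>2" by (metis linorder_less_linear)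
    then have "R = {} \<or> (\<exists>t. R = {t})" by blast
    \<comment> \<open>a single finite positive limit is absorbed into the exceptional set\<close>
    then have "countable (A \<union> R)" using A by auto
    from rescaled_mono_zero_or_infinity[OF mono nonneg \<phi> this lim'] that(1,2,4)
    show ?thesis by blast
  next
    case True
    then obtain t\<^sub>1 t\<^sub>2 where R: "t\<^sub>1 \<in> R" "t\<^sub>2 \<in> R" and "t\<^sub>1 < t\<^sub>2" by auto
    \<comment> \<open>A positive limit at \<open>t\<^sub>1\<close> makes \<open>k\<close> positive
      at points arbitrarily close to 0, and monotonicity carries this to every
      \<open>t\<close>.\<close>
    have kpos: "k t > 0" if "t > 0" for t
    proof -
      obtain a where "a > 0" and a: "((\<lambda>l. \<phi> l * k (l * t\<^sub>1)) \<longlongrightarrow> a) (at_right 0)" and "t\<^sub>1 > 0"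
        using R by (auto simp: R_def)
      have "\<forall>\<^sub>F l in at_right 0. l < t / t\<^sub>1 \<and> 0 < l \<and> 0 < \<phi> l * k (l * t\<^sub>1)"
        using order_tendstoD(1)[OF a \<open>a > 0\<close>] that \<open>t\<^sub>1 > 0\<close>
        by (intro eventually_conj eventually_at_right_less) (auto intro: eventually_at_rightI[of 0 "t / t\<^sub>1"])
      then obtain l where l: "l < t / t\<^sub>1" "0 < l" "0 < \<phi> l * k (l * t\<^sub>1)"
        using eventually_happens' trivial_limit_at_right_real by blast
      then have "0 < k (l * t\<^sub>1)" using \<phi>[of l] by (simp add: zero_less_mult_iff)
      also have "\<dots> \<le> k t"
        using l \<open>t\<^sub>1 > 0\<close> that by (intro mono_onD[OF mono]) (auto simp: field_simps)
      finally show ?thesis .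
    qed
    \<comment> \<open>Dividing two limits from \<open>R\<close> cancels the normalisation \<phi>;
      replacing \<open>l\<close> by \<open>l * (1 / s)\<close> brings the quotient to the base point
      \<open>l\<close>.\<close>
    have ratio: "\<exists>g>0. ((\<lambda>l. k (l * (t / s)) / k l) \<longlongrightarrow> g) (at_right 0)" if st: "s \<in> R" "t \<in> R" for s t
    proof -
      obtain a b where "s > 0" "a > 0" "b > 0"
        and a: "((\<lambda>l. \<phi> l * k (l * s)) \<longlongrightarrow> a) (at_right 0)"
        and b: "((\<lambda>l. \<phi> l * k (l * t)) \<longlongrightarrow> b) (at_right 0)"
        using st by (auto simp: R_def)
      have "((\<lambda>l. (\<phi> l * k (l * t)) / (\<phi> l * k (l * s))) \<longlongrightarrow> b / a) (at_right 0)"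
        using a b \<open>a > 0\<close> by (intro tendsto_divide) auto
      then have "((\<lambda>l. k (l * t) / k (l * s)) \<longlongrightarrow> b / a) (at_right 0)"
      proof (rule tendsto_cong[THEN iffD1, rotated])
        show "\<forall>\<^sub>F l in at_right 0. \<phi> l * k (l * t) / (\<phi> l * k (l * s)) = k (l * t) / k (l * s)"
          using eventually_at_right_less[of 0] by eventually_elim (use \<phi> in force)
      qed
      from filterlim_compose[OF this filterlim_mult_at_right_0[of "1 / s"]] \<open>s > 0\<close> \<open>a > 0\<close> \<open>b > 0\<close>
      show ?thesis by (intro exI[of _ "b / a"]) simp
    qed
    \<comment> \<open>Conversely, \<open>R\<close> is stable under multiplication by any ratio at
      which the quotient of \<open>k\<close> has a positive limit.\<close>
    have shift: "s * r \<in> R" if s: "s \<in> R" and "r > 0" "g > 0"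
      and g: "((\<lambda>l. k (l * r) / k l) \<longlongrightarrow> g) (at_right 0)" for s r g
    proof -
      obtain a where "s > 0" "a > 0" and a: "((\<lambda>l. \<phi> l * k (l * s)) \<longlongrightarrow> a) (at_right 0)"
        using s by (auto simp: R_def)
      have "((\<lambda>l. \<phi> l * k (l * s) * (k (l * s * r) / k (l * s))) \<longlongrightarrow> a * g) (at_right 0)"
        by (intro tendsto_mult a filterlim_compose[OF g filterlim_mult_at_right_0] \<open>s > 0\<close>)
      then have "((\<lambda>l. \<phi> l * k (l * (s * r))) \<longlongrightarrow> a * g) (at_right 0)"
      proof (rule tendsto_cong[THEN iffD1, rotated])
        show "\<forall>\<^sub>F l in at_right 0. \<phi> l * k (l * s) * (k (l * s * r) / k (l * s)) = \<phi> l * k (l * (s * r))"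
          using eventually_at_right_less[of 0]
        proof eventually_elim
          case (elim l)
          then show ?case using kpos[of "l * s"] \<open>s > 0\<close> by (simp add: mult.assoc)
        qed
      qed
      with \<open>s > 0\<close> \<open>r > 0\<close> \<open>a > 0\<close> \<open>g > 0\<close> show ?thesis
        unfolding R_def by (auto intro!: exI[of _ "a * g"])
    qed
    have "t\<^sub>1 > 0" "t\<^sub>2 > 0" using R by (auto simp: R_def)
    define q where "q = t\<^sub>2 / t\<^sub>1"
    have "q > 1" using \<open>t\<^sub>1 < t\<^sub>2\<close> \<open>t\<^sub>1 > 0\<close> by (simp add: q_def)
    obtain g g' where g: "g > 0" "((\<lambda>l. k (l * q) / k l) \<longlongrightarrow> g) (at_right 0)"
        "g' > 0" "((\<lambda>l. k (l * (1 / q)) / k l) \<longlongrightarrow> g') (at_right 0)"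
      using ratio[of t\<^sub>1 t\<^sub>2] ratio[of t\<^sub>2 t\<^sub>1] R by (auto simp: q_def)
    have up: "t\<^sub>1 * q ^ n \<in> R" for n
    proof (induction n)
      case (Suc n)
      then show ?case using shift[OF Suc _ g(1,2)] \<open>q > 1\<close> by (simp add: mult_ac)
    qed (use R in simp)
    have down: "t\<^sub>1 / q ^ n \<in> R" for n
    proof (induction n)
      case (Suc n)
      then show ?case using shift[OF Suc _ g(3,4)] \<open>q > 1\<close> by (simp add: mult_ac)
    qed (use R in simp)
    have le: "\<forall>\<^sub>F l in at_right 0. \<phi> l * k (l * s) \<le> \<phi> l * k (l * t)" if "0 < s" "s \<le> t" for s t
      using eventually_at_right_less[of 0]
    proof eventually_elim
      case (elim l)
      then show ?case
        using that \<phi>[of l] by (intro mult_left_mono mono_onD[OF mono]) auto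
    qed
    \<comment> \<open>The points \<open>t\<^sub>1 * q ^ n\<close> and
      \<open>t\<^sub>1 / q ^ m\<close> of \<open>R\<close> enclose \<open>t\<close>. The upper one
      rules out an infinite limit at \<open>t\<close>, the lower one a zero limit.\<close>
    have all: "t \<in> R" if "t > 0" "t \<notin> A" for t
    proof -
      obtain n where "t / t\<^sub>1 < q ^ n" using real_arch_pow[OF \<open>q > 1\<close>] by blast
      then have n: "t \<le> t\<^sub>1 * q ^ n" using \<open>t\<^sub>1 > 0\<close> by (simp add: field_simps)
      obtain m where "t\<^sub>1 / t < q ^ m" using real_arch_pow[OF \<open>q > 1\<close>] by blast
      then have m: "t\<^sub>1 / q ^ m \<le> t" "0 < t\<^sub>1 / q ^ m"
        using \<open>t\<^sub>1 > 0\<close> \<open>t > 0\<close> \<open>q > 1\<close> by (simp_all add: field_simps)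
      obtain a where a: "((\<lambda>l. \<phi> l * k (l * (t\<^sub>1 * q ^ n))) \<longlongrightarrow> a) (at_right 0)"
        using up by (auto simp: R_def)
      obtain b where "b > 0" and b: "((\<lambda>l. \<phi> l * k (l * (t\<^sub>1 / q ^ m))) \<longlongrightarrow> b) (at_right 0)"
        using down by (auto simp: R_def)
      from lim[OF that] show ?thesis
      proof (elim disjE exE conjE)
        fix c assume "((\<lambda>l. \<phi> l * k (l * t)) \<longlongrightarrow> c) (at_right 0)"
        moreover from tendsto_le[OF _ this b le[OF m(2,1)]] \<open>b > 0\<close> have "c > 0" by simp
        ultimately show ?thesis using \<open>t > 0\<close> by (auto simp: R_def)
      next
        assume "filterlim (\<lambda>l. \<phi> l * k (l * t)) at_top (at_right 0)"
        then have "filterlim (\<lambda>l. \<phi> l * k (l * (t\<^sub>1 * q ^ n))) at_top (at_right 0)"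
          using le[OF \<open>t > 0\<close> n] by (rule filterlim_at_top_mono)
        with a show ?thesis
          using not_tendsto_and_filterlim_at_infinity filterlim_at_top_imp_at_infinity
            trivial_limit_at_right_real by blast
      qed
    qed
    have vary: "\<exists>g>0. ((\<lambda>l. k (l * r) / k l) \<longlongrightarrow> g) (at_right 0)" if "r > 0" for r
    proof -
      \<comment> \<open>Choosing \<open>s\<close> outside both \<open>A\<close> and \<open>A\<close>
        divided by \<open>r\<close> puts \<open>s\<close> and \<open>s * r\<close> in
        \<open>R\<close> together, so the ratio \<open>r\<close> is reached even if \<open>r\<close>
        itself is exceptional.\<close>
      have "countable (A \<union> (\<lambda>t. t / r) ` A)" using A by simp
      then obtain s where s: "0 < s" "s < 1" "s \<notin> A \<union> (\<lambda>t. t / r) ` A"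
        by (rule exists_between_notin_countable[of _ 0 1]) auto
      then have "s * r \<notin> A" using that by (auto simp: image_iff)
      then have "s \<in> R" "s * r \<in> R" using all s that by auto
      from ratio[OF this] s show ?thesis by simp
    qed
    obtain \<beta> where \<beta>: "\<beta> \<ge> 0"
        "\<And>s. s > 0 \<Longrightarrow> ((\<lambda>l. k (l * s) / k l) \<longlongrightarrow> s powr \<beta>) (at_right 0)"
      using regularly_varying_mono_index[OF mono kpos vary] by blast
    \<comment> \<open>The point 1 might lie in \<open>A\<close>. Regular variation transports the
      limit from \<open>t\<^sub>1\<close> to 1 and yields the constant \<open>c\<close>.\<close>
    have "t\<^sub>1 * (1 / t\<^sub>1) \<in> R"
      using \<open>t\<^sub>1 > 0\<close> by (intro shift[OF R(1) _ _ \<beta>(2)]) auto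
    then obtain c where "c > 0" "((\<lambda>l. \<phi> l * k l) \<longlongrightarrow> c) (at_right 0)"
      using \<open>t\<^sub>1 > 0\<close> by (auto simp: R_def)
    with that(3) \<beta> show ?thesis by blast
  qed
qed

section \<open>Scaling limits of d-inverses\<close>

text \<open>The d-inverses form one family indexed by the drift, so that the rescaled drifts, the
  zero drift and the power drifts are treated uniformly. The laws in the first three cases are
  stated as implications, valid for every choice of parameters meeting the condition of the
  case.\<close>

theorem theorem3p1:
  fixes M :: "'a measure" and B :: "real \<Rightarrow> 'a \<Rightarrow> real"
    and N :: "(real \<Rightarrow> real) \<Rightarrow> 'b measure" and Y :: "(real \<Rightarrow> real) \<Rightarrow> real \<Rightarrow> 'b \<Rightarrow> ereal"
    and L :: "'c measure" and Z :: "real \<Rightarrow> 'c \<Rightarrow> ereal"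
    and \<rho> \<phi>\<^sub>1 \<phi>\<^sub>2 :: "real \<Rightarrow> real" and p :: real
  assumes B: "standard_brownian_motion M B"
    and Y: "\<And>r. admissible_drift r \<Longrightarrow> d_inverse (N r) (Y r) M (\<lambda>t \<omega>. ereal (B t \<omega> + r t))"
    and \<rho>: "\<And>t. t \<ge> 0 \<Longrightarrow> \<rho> t \<ge> 0" "admissible_drift \<rho>"
    and \<phi>\<^sub>1: "\<phi>\<^sub>1 \<in> borel_measurable (lebesgue_on {0<..})" "\<And>l. l > 0 \<Longrightarrow> \<phi>\<^sub>1 l > 0"
    and \<phi>\<^sub>2: "\<phi>\<^sub>2 \<in> borel_measurable (lebesgue_on {0<..})" "\<And>l. l > 0 \<Longrightarrow> \<phi>\<^sub>2 l > 0"
    and Z: "prob_space L" "\<And>x. x \<ge> 0 \<Longrightarrow> Z x \<in> borel_measurable L"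
      "\<And>x \<omega>. x \<ge> 0 \<Longrightarrow> \<omega> \<in> space L \<Longrightarrow> 0 \<le> Z x \<omega>"
    and conv: "\<And>x. x \<ge> 0 \<Longrightarrow>
      conv_distr_at_0 (\<lambda>l. N (\<lambda>t. \<phi>\<^sub>1 l * \<rho> t))
        (\<lambda>l \<omega>. ereal (1 / l) * Y (\<lambda>t. \<phi>\<^sub>1 l * \<rho> t) (\<phi>\<^sub>2 l * x) \<omega>) L (Z x)"
    and p: "p \<ge> 0" "((\<lambda>l. \<phi>\<^sub>2 l / sqrt l) \<longlongrightarrow> p) (at_right 0)"
  defines "case_i \<equiv> (\<forall>t>0. ((\<lambda>l. \<phi>\<^sub>1 l * \<rho> (l * t) / sqrt l) \<longlongrightarrow> 0) (at_right 0))"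
    and "case_ii \<equiv> (\<lambda>t\<^sub>0. t\<^sub>0 > 0 \<and>
      (\<forall>t. 0 < t \<and> t < t\<^sub>0 \<longrightarrow> ((\<lambda>l. \<phi>\<^sub>1 l * \<rho> (l * t) / sqrt (l * t)) \<longlongrightarrow> 0) (at_right 0)) \<and>
      (\<forall>t>t\<^sub>0. filterlim (\<lambda>l. \<phi>\<^sub>1 l * \<rho> (l * t) / sqrt (l * t)) at_top (at_right 0)) \<and>
      ((\<lambda>l. \<phi>\<^sub>2 l / sqrt l) \<longlongrightarrow> p) (at_right 0))"
    and "case_iii \<equiv> (\<lambda>c \<alpha>. c > 0 \<and> \<alpha> \<ge> 1 / 2 \<and>
      (\<forall>t>0. ((\<lambda>l. \<rho> (l * t) / \<rho> l) \<longlongrightarrow> t powr \<alpha>) (at_right 0)) \<and>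
      ((\<lambda>l. \<rho> l / sqrt l * \<phi>\<^sub>1 l) \<longlongrightarrow> c) (at_right 0) \<and>
      ((\<lambda>l. 1 / sqrt l * \<phi>\<^sub>2 l) \<longlongrightarrow> p) (at_right 0))"
    and "case_iv \<equiv> (\<forall>x>0. measure L {\<omega> \<in> space L. Z x \<omega> = 0} = 1)"
  shows "(case_i \<or> (\<exists>t\<^sub>0. case_ii t\<^sub>0) \<or> (\<exists>c \<alpha>. case_iii c \<alpha>) \<or> case_iv) \<and>
    (case_i \<longrightarrow> (\<forall>x\<ge>0. eq_distr L (Z x) (N (\<lambda>_. 0)) (Y (\<lambda>_. 0) (p * x)))) \<and>
    (\<forall>t\<^sub>0. case_ii t\<^sub>0 \<longrightarrow>
      (\<forall>x\<ge>0. eq_distr L (Z x) (N (\<lambda>_. 0)) (\<lambda>\<omega>. min (Y (\<lambda>_. 0) (p * x) \<omega>) (ereal t\<^sub>0)))) \<and>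
    (\<forall>c \<alpha>. case_iii c \<alpha> \<longrightarrow>
      (\<forall>x\<ge>0. eq_distr L (Z x) (N (\<lambda>t. c * t powr \<alpha>)) (Y (\<lambda>t. c * t powr \<alpha>) (p * x))))"
proof -
  interpret L: prob_space L by (rule Z(1))
  define k where "k t = \<rho> t / sqrt t" for t
  define h where "h l u = \<phi>\<^sub>1 l * k (l * u)" for l u
  \<comment> \<open>\<open>A x\<close> collects the real atoms of \<open>Z x\<close>, the points
    where convergence in distribution gives no information.\<close>
  define A where "A x = {u :: real. measure L {\<omega> \<in> space L. Z x \<omega> = ereal u} \<noteq> 0}" for x
  have k_mono: "mono_on {0<..} k"
    using \<rho>(2) by (simp add: admissible_drift_def k_def[abs_def])
  have k_nonneg: "k t \<ge> 0" if "t > 0" for t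
    using \<rho>(1)[of t] that by (simp add: k_def)
  have A: "countable (A x)" if "x \<ge> 0" for x
    unfolding A_def by (rule L.countable_atoms_ereal[OF Z(2)[OF that]])
  have notin_A: "AE u in lborel. u \<notin> A x" if "x \<ge> 0" for x
    by (intro AE_not_in countable_imp_null_set_lborel A that)

  \<comment> \<open>Distribution functions before and after the limit\<close>
  have Y_cdf: "measure (N r) {\<omega> \<in> space (N r). Y r x \<omega> \<le> ereal t} = normal_cdf ((r t - x) / sqrt t)"
    if "admissible_drift r" "x \<ge> 0" "t > 0" for r x t
    using d_inverse_drift_cdf[OF B that(1) Y[OF that(1)] that(2,3)] .
  \<comment> \<open>The factor \<open>1 / l\<close> moves the evaluation time to
    \<open>l * u\<close>, and \<open>sqrt (l * u)\<close> splits so that only \<open>h l u\<close>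
    and \<open>\<phi>\<^sub>2 l / sqrt l\<close> depend on \<open>l\<close>.\<close>
  have h_cdf: "measure (N (\<lambda>t. \<phi>\<^sub>1 l * \<rho> t)) {\<omega> \<in> space (N (\<lambda>t. \<phi>\<^sub>1 l * \<rho> t)).
        ereal (1 / l) * Y (\<lambda>t. \<phi>\<^sub>1 l * \<rho> t) (\<phi>\<^sub>2 l * x) \<omega> \<le> ereal u} =
      normal_cdf (h l u - \<phi>\<^sub>2 l / sqrt l * x / sqrt u)" if "l > 0" "x \<ge> 0" "u > 0" for l x u
  proof -
    have "ereal (1 / l) * y \<le> ereal u \<longleftrightarrow> y \<le> ereal (l * u)" for y
      using \<open>l > 0\<close> by (cases y) (auto simp: field_simps)
    moreover have "(\<phi>\<^sub>1 l * \<rho> (l * u) - \<phi>\<^sub>2 l * x) / sqrt (l * u) = h l u - \<phi>\<^sub>2 l / sqrt l * x / sqrt u"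
      by (simp add: h_def k_def diff_divide_distrib real_sqrt_mult)
    ultimately show ?thesis
      using Y_cdf[OF admissible_drift_scale[OF \<rho>(2)], of "\<phi>\<^sub>1 l" "\<phi>\<^sub>2 l * x" "l * u"]
        \<phi>\<^sub>1(2) \<phi>\<^sub>2(2) that by (simp add: less_imp_le)
  qed
  have Z_lim: "((\<lambda>l. normal_cdf (h l u - \<phi>\<^sub>2 l / sqrt l * x / sqrt u)) \<longlongrightarrow>
      measure L {\<omega> \<in> space L. Z x \<omega> \<le> ereal u}) (at_right 0)"
    if "x \<ge> 0" "u > 0" "u \<notin> A x" for x u
  proof -
    have "((\<lambda>l. measure (N (\<lambda>t. \<phi>\<^sub>1 l * \<rho> t)) {\<omega> \<in> space (N (\<lambda>t. \<phi>\<^sub>1 l * \<rho> t)).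
        ereal (1 / l) * Y (\<lambda>t. \<phi>\<^sub>1 l * \<rho> t) (\<phi>\<^sub>2 l * x) \<omega> \<le> ereal u}) \<longlongrightarrow>
      measure L {\<omega> \<in> space L. Z x \<omega> \<le> ereal u}) (at_right 0)"
      using conv[OF \<open>x \<ge> 0\<close>] \<open>u \<notin> A x\<close> unfolding conv_distr_at_0_def A_def by blast
    moreover have "\<forall>\<^sub>F l in at_right 0. measure (N (\<lambda>t. \<phi>\<^sub>1 l * \<rho> t)) {\<omega> \<in> space (N (\<lambda>t. \<phi>\<^sub>1 l * \<rho> t)).
        ereal (1 / l) * Y (\<lambda>t. \<phi>\<^sub>1 l * \<rho> t) (\<phi>\<^sub>2 l * x) \<omega> \<le> ereal u} =
      normal_cdf (h l u - \<phi>\<^sub>2 l / sqrt l * x / sqrt u)"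
      using eventually_at_right_less[of 0] by eventually_elim (use h_cdf that in blast)
    ultimately show ?thesis by (rule Lim_transform_eventually)
  qed
  have Z_cdf: "measure L {\<omega> \<in> space L. Z x \<omega> \<le> ereal u} = normal_cdf (a - p * x / sqrt u)"
    if "((\<lambda>l. h l u) \<longlongrightarrow> a) (at_right 0)" "x \<ge> 0" "u > 0" "u \<notin> A x" for a x u
  proof (rule tendsto_unique[OF _ Z_lim])
    have "((\<lambda>l. h l u - \<phi>\<^sub>2 l / sqrt l * x / sqrt u) \<longlongrightarrow> a - p * x / sqrt u) (at_right 0)"
      using that by (intro tendsto_intros p(2)) auto
    then show "((\<lambda>l. normal_cdf (h l u - \<phi>\<^sub>2 l / sqrt l * x / sqrt u)) \<longlongrightarrow>
        normal_cdf (a - p * x / sqrt u)) (at_right 0)"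
      by (rule isCont_tendsto_compose[OF continuous_normal_cdf])
  qed (use that in auto)
  have Z_cdf_top: "measure L {\<omega> \<in> space L. Z x \<omega> \<le> ereal u} = 1"
    if "filterlim (\<lambda>l. h l u) at_top (at_right 0)" "x \<ge> 0" "u > 0" "u \<notin> A x" for x u
  proof (rule tendsto_unique[OF _ Z_lim])
    interpret real_distribution std_normal_distribution by (rule real_dist_normal_dist)
    \<comment> \<open>Since \<open>p\<close> is finite, the subtracted term converges and cannot
      offset the divergence of \<open>h l u\<close>.\<close>
    have "((\<lambda>l. - (\<phi>\<^sub>2 l / sqrt l * x / sqrt u)) \<longlongrightarrow> - (p * x / sqrt u)) (at_right 0)"
      using that by (intro tendsto_intros p(2)) auto
    from filterlim_tendsto_add_at_top[OF this that(1)]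
    have "filterlim (\<lambda>l. h l u - \<phi>\<^sub>2 l / sqrt l * x / sqrt u) at_top (at_right 0)" by simp
    then show "((\<lambda>l. normal_cdf (h l u - \<phi>\<^sub>2 l / sqrt l * x / sqrt u)) \<longlongrightarrow> 1) (at_right 0)"
      by (rule filterlim_compose[OF cdf_lim_at_top_prob])
  qed (use that in auto)

  \<comment> \<open>Besides the atoms in \<open>A x\<close>, a further countable set
    \<open>E\<close> may be left out; it serves to skip the jump point in the second case.\<close>
  have eq_distrI: "eq_distr L (Z x) (N r) V"
    if r: "admissible_drift r" and x: "x \<ge> 0"
      and V: "V \<in> borel_measurable (N r)" "\<And>\<omega>. \<omega> \<in> space (N r) \<Longrightarrow> 0 \<le> V \<omega>"
      and E: "countable E"
      and eq: "\<And>u. u > 0 \<Longrightarrow> u \<notin> A x \<Longrightarrow> u \<notin> E \<Longrightarrow> measure L {\<omega> \<in> space L. Z x \<omega> \<le> ereal u} =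
        measure (N r) {\<omega> \<in> space (N r). V \<omega> \<le> ereal u}" for x r V E
  proof (rule eq_distr_nonneg_AE)
    show "prob_space (N r)" using Y[OF r] by (simp add: d_inverse_def)
    have "AE u in lborel. u \<notin> E" by (intro AE_not_in countable_imp_null_set_lborel E)
    with notin_A[OF x] show "AE u in lborel. 0 < u \<longrightarrow> measure L {\<omega> \<in> space L. Z x \<omega> \<le> ereal u} =
        measure (N r) {\<omega> \<in> space (N r). V \<omega> \<le> ereal u}"
      by eventually_elim (use eq in blast)
  qed (use Z x V in auto)
  have Y_rv: "Y r x \<in> borel_measurable (N r)" "\<And>\<omega>. \<omega> \<in> space (N r) \<Longrightarrow> 0 \<le> Y r x \<omega>"
    if "admissible_drift r" "x \<ge> 0" for r x
    using Y[OF that(1)] that(2) by (auto simp: d_inverse_def)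
  have adm0: "admissible_drift (\<lambda>_. 0)"
    using admissible_drift_power[of 0 1] by simp

  \<comment> \<open>The law of the limit in the first three cases\<close>
  have law_i: "eq_distr L (Z x) (N (\<lambda>_. 0)) (Y (\<lambda>_. 0) (p * x))" if case_i "x \<ge> 0" for x
  proof (rule eq_distrI[OF adm0 \<open>x \<ge> 0\<close> Y_rv[OF adm0]])
    fix u :: real assume u: "u > 0" "u \<notin> A x" "u \<notin> {}"
    have "((\<lambda>l. \<phi>\<^sub>1 l * \<rho> (l * u) / sqrt l / sqrt u) \<longlongrightarrow> 0 / sqrt u) (at_right 0)"
      using that u by (intro tendsto_divide tendsto_const) (auto simp: case_i_def)
    then have "((\<lambda>l. h l u) \<longlongrightarrow> 0) (at_right 0)"
      by (simp add: h_def k_def real_sqrt_mult)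
    from Z_cdf[OF this \<open>x \<ge> 0\<close> u(1,2)] Y_cdf[OF adm0, of "p * x" u] u p that
    show "measure L {\<omega> \<in> space L. Z x \<omega> \<le> ereal u} =
        measure (N (\<lambda>_. 0)) {\<omega> \<in> space (N (\<lambda>_. 0)). Y (\<lambda>_. 0) (p * x) \<omega> \<le> ereal u}" by simp
  qed (use p that in auto)

  have law_ii: "eq_distr L (Z x) (N (\<lambda>_. 0)) (\<lambda>\<omega>. min (Y (\<lambda>_. 0) (p * x) \<omega>) (ereal t\<^sub>0))"
    if ii: "case_ii t\<^sub>0" and "x \<ge> 0" for t\<^sub>0 x
  proof (rule eq_distrI[OF adm0 \<open>x \<ge> 0\<close>])
    have px: "p * x \<ge> 0" using p \<open>x \<ge> 0\<close> by simp
    note Y_rv = Y_rv[OF adm0 px]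
    interpret N0: prob_space "N (\<lambda>_. 0)" using Y[OF adm0] by (simp add: d_inverse_def)
    show "(\<lambda>\<omega>. min (Y (\<lambda>_. 0) (p * x) \<omega>) (ereal t\<^sub>0)) \<in> borel_measurable (N (\<lambda>_. 0))"
      using Y_rv(1) by simp
    show "0 \<le> min (Y (\<lambda>_. 0) (p * x) \<omega>) (ereal t\<^sub>0)" if "\<omega> \<in> space (N (\<lambda>_. 0))" for \<omega>
      using Y_rv(2)[OF that] ii by (simp add: case_ii_def)
    show "countable {t\<^sub>0}" by simp
    fix u :: real assume u: "u > 0" "u \<notin> A x" "u \<notin> {t\<^sub>0}"
    have h: "(\<lambda>l. \<phi>\<^sub>1 l * \<rho> (l * u) / sqrt (l * u)) = (\<lambda>l. h l u)"
      by (simp add: h_def k_def)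
    \<comment> \<open>Below \<open>t\<^sub>0\<close> the truncation is invisible and the driftless
      law appears; above \<open>t\<^sub>0\<close> both distribution functions equal 1.\<close>
    from u(3) consider "u < t\<^sub>0" | "u > t\<^sub>0" by force
    then show "measure L {\<omega> \<in> space L. Z x \<omega> \<le> ereal u} = measure (N (\<lambda>_. 0))
        {\<omega> \<in> space (N (\<lambda>_. 0)). min (Y (\<lambda>_. 0) (p * x) \<omega>) (ereal t\<^sub>0) \<le> ereal u}"
    proof cases
      case 1
      have "((\<lambda>l. h l u) \<longlongrightarrow> 0) (at_right 0)"
        using ii 1 u(1) unfolding case_ii_def h[symmetric] by blast
      from Z_cdf[OF this \<open>x \<ge> 0\<close> u(1,2)] Y_cdf[OF adm0 px u(1)] 1
      show ?thesis by (simp add: min_le_iff_disj)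
    next
      case 2
      have "filterlim (\<lambda>l. h l u) at_top (at_right 0)"
        using ii 2 unfolding case_ii_def h[symmetric] by blast
      from Z_cdf_top[OF this \<open>x \<ge> 0\<close> u(1,2)] 2
      show ?thesis by (simp add: min_le_iff_disj N0.prob_space)
    qed
  qed

  have law_iii: "eq_distr L (Z x) (N (\<lambda>t. c * t powr \<alpha>)) (Y (\<lambda>t. c * t powr \<alpha>) (p * x))"
    if iii: "case_iii c \<alpha>" and "x \<ge> 0" for c \<alpha> x
  proof -
    have adm: "admissible_drift (\<lambda>t. c * t powr \<alpha>)"
      using iii by (intro admissible_drift_power) (auto simp: case_iii_def)
    have px: "p * x \<ge> 0" using p \<open>x \<ge> 0\<close> by simp
    show ?thesis
    proof (rule eq_distrI[OF adm \<open>x \<ge> 0\<close> Y_rv[OF adm px]])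
      fix u :: real assume u: "u > 0" "u \<notin> A x" "u \<notin> {}"
      have c: "((\<lambda>l. \<rho> l / sqrt l * \<phi>\<^sub>1 l) \<longlongrightarrow> c) (at_right 0)" and "c > 0"
        using iii by (auto simp: case_iii_def)
      have "((\<lambda>l. \<rho> (l * u) / \<rho> l * (\<rho> l / sqrt l * \<phi>\<^sub>1 l) / sqrt u) \<longlongrightarrow> u powr \<alpha> * c / sqrt u) (at_right 0)"
        using iii u by (intro tendsto_intros c) (auto simp: case_iii_def)
      \<comment> \<open>Cancelling \<open>\<rho> l\<close> requires it to be nonzero, which holds
        eventually because the second factor tends to \<open>c > 0\<close>.\<close>
      moreover have "\<forall>\<^sub>F l in at_right 0. \<rho> (l * u) / \<rho> l * (\<rho> l / sqrt l * \<phi>\<^sub>1 l) / sqrt u = h l u"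
        using order_tendstoD(1)[OF c \<open>c > 0\<close>]
        by eventually_elim (auto simp: h_def k_def real_sqrt_mult)
      ultimately have "((\<lambda>l. h l u) \<longlongrightarrow> u powr \<alpha> * c / sqrt u) (at_right 0)"
        by (rule Lim_transform_eventually)
      from Z_cdf[OF this \<open>x \<ge> 0\<close> u(1,2)] Y_cdf[OF adm px u(1)]
      show "measure L {\<omega> \<in> space L. Z x \<omega> \<le> ereal u} = measure (N (\<lambda>t. c * t powr \<alpha>))
          {\<omega> \<in> space (N (\<lambda>t. c * t powr \<alpha>)). Y (\<lambda>t. c * t powr \<alpha>) (p * x) \<omega> \<le> ereal u}"
        by (simp add: diff_divide_distrib mult.commute)
    qed auto
  qed

  \<comment> \<open>The four-way alternative\<close>
  have limits: "(\<exists>a\<ge>0. ((\<lambda>l. \<phi>\<^sub>1 l * k (l * t)) \<longlongrightarrow> a) (at_right 0)) \<or>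
      filterlim (\<lambda>l. \<phi>\<^sub>1 l * k (l * t)) at_top (at_right 0)" if "t > 0" "t \<notin> A 0" for t
  proof (rule normal_cdf_limit_cases)
    \<comment> \<open>At \<open>x = 0\<close> the term with \<open>\<phi>\<^sub>2\<close>
      disappears, so the law of \<open>Z 0\<close> alone controls the rescaled drift.\<close>
    show "((\<lambda>l. normal_cdf (\<phi>\<^sub>1 l * k (l * t))) \<longlongrightarrow> measure L {\<omega> \<in> space L. Z 0 \<omega> \<le> ereal t}) (at_right 0)"
      using Z_lim[of 0 t] that by (simp add: h_def)
    show "\<forall>\<^sub>F l in at_right 0. 0 \<le> \<phi>\<^sub>1 l * k (l * t)"
      using eventually_at_right_less[of 0]
      by eventually_elim (use \<open>t > 0\<close> in \<open>simp add: k_nonneg \<phi>\<^sub>1(2) less_imp_le\<close>)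
  qed simp
  have "case_i \<or> (\<exists>t\<^sub>0. case_ii t\<^sub>0) \<or> (\<exists>c \<alpha>. case_iii c \<alpha>) \<or> case_iv"
  proof (rule rescaled_mono_limit_cases[OF k_mono k_nonneg \<phi>\<^sub>1(2) A[OF order_refl] limits], goal_cases)
    case zero: 5
    have "((\<lambda>l. \<phi>\<^sub>1 l * \<rho> (l * t) / sqrt l) \<longlongrightarrow> 0) (at_right 0)" if "t > 0" for t
      using tendsto_mult_right[OF zero[OF that], of "sqrt t"] that
      by (simp add: k_def real_sqrt_mult)
    then show ?thesis by (simp add: case_i_def)
  next
    case jump: (6 t\<^sub>0)
    then have "case_ii t\<^sub>0"
      using p(2) by (simp add: case_ii_def k_def)
    then show ?thesis by blast
  next
    case power: (7 c \<beta>)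
    \<comment> \<open>If \<open>k\<close> has index \<beta>, then \<rho>, being \<open>k\<close>
      times the square root, has index \<beta> + 1/2; hence the bound \<alpha> \<ge> 1/2.\<close>
    have "((\<lambda>l. \<rho> (l * t) / \<rho> l) \<longlongrightarrow> t powr (\<beta> + 1 / 2)) (at_right 0)" if "t > 0" for t
    proof -
      have "((\<lambda>l. k (l * t) / k l * sqrt t) \<longlongrightarrow> t powr \<beta> * sqrt t) (at_right 0)"
        by (intro tendsto_intros power that)
      moreover have "\<forall>\<^sub>F l in at_right 0. k (l * t) / k l * sqrt t = \<rho> (l * t) / \<rho> l"
        using eventually_at_right_less[of 0]
        by eventually_elim (use that in \<open>simp add: k_def real_sqrt_mult\<close>)
      ultimately show ?thesis
        using that by (auto simp: powr_add powr_half_sqrt dest: Lim_transform_eventually)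
    qed
    then have "case_iii c (\<beta> + 1 / 2)"
      using power p(2) by (simp add: case_iii_def k_def mult.commute)
    then show ?thesis by blast
  next
    case infinity: 8
    have "measure L {\<omega> \<in> space L. Z x \<omega> = 0} = 1" if "x > 0" for x
    proof -
      \<comment> \<open>All mass of \<open>Z x\<close> lies below almost every positive
        \<open>u\<close>; right-continuity at 0 and nonnegativity concentrate it at 0.\<close>
      have "AE u in lborel. 0 < u \<longrightarrow> measure L {\<omega> \<in> space L. Z x \<omega> \<le> ereal u} = 1"
        using notin_A[OF less_imp_le[OF that]]
        by eventually_elim (use Z_cdf_top[of _ x] infinity that in \<open>simp add: h_def\<close>)
      then have "measure L {\<omega> \<in> space L. Z x \<omega> \<le> ereal 0} = 1"
        using that by (intro continuous_at_right_eq_AE[where G = "\<lambda>_. 1" and a = 0]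
            L.continuous_at_right_measure_ereal_le Z(2)) auto
      moreover have "{\<omega> \<in> space L. Z x \<omega> \<le> ereal 0} = {\<omega> \<in> space L. Z x \<omega> = 0}"
        using Z(3)[of x] that by (auto simp: zero_ereal_def[symmetric] intro: antisym)
      ultimately show ?thesis by simp
    qed
    then show ?thesis by (simp add: case_iv_def)
  qed
  with law_i law_ii law_iii show ?thesis by blast
qed

end
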